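(* Let $\Theta$ be an $r\times s$ matrix with real entries. The following are equivalent: (1) the columns of $\Theta$ are inhomogeneously independent over $\mathbb{Q}$; (2) the inhomogeneous error map $\varepsilon(\Theta):{}^{\ast}\mathbb{Z}^{s}(\Theta)\to{}^{\ast}\mathbb{R}^{r}_{\varepsilon}(\Theta)$ is an isomorphism; (3) ${}^{\ast}\mathbb{Z}^{s}(\Theta)$ contains no nonzero ${}^{\ast}\mathbb{Z}$-ideal in ${}^{\ast}\mathbb{Z}^{s}$, i.e. no nonzero subgroup of ${}^{\ast}\mathbb{Z}^{s}$ stable under multiplication by scalars in ${}^{\ast}\mathbb{Z}$.
   Context: Fix a non-principal ultrafilter on $\mathbb{N}$; ${}^{\ast}\mathbb{Z}\subset{}^{\ast}\mathbb{R}$ are the ultrapowers of $\mathbb{Z}$, $\mathbb{R}$ and ${}^{\ast}\mathbb{R}_{\varepsilon}$ is the group of infinitesimals. The inhomogeneous diophantine approximation group is $${}^{\ast}\mathbb{Z}^{s}(\Theta)=\{{}^{\ast}\boldsymbol{n}\in{}^{\ast}\mathbb{Z}^{s}\mid\exists\,{}^{\ast}\boldsymbol{n}^{\perp}\in{}^{\ast}\mathbb{Z}^{r}\text{ with }\Theta\,{}^{\ast}\boldsymbol{n}-{}^{\ast}\boldsymbol{n}^{\perp}\in{}^{\ast}\mathbb{R}_{\varepsilon}^{r}\};$$ ${}^{\ast}\boldsymbol{n}^{\perp}$ is unique. The inhomogeneous error map is $\varepsilon(\Theta)({}^{\ast}\boldsymbol{n})=\Theta\,{}^{\ast}\boldsymbol{n}-{}^{\ast}\boldsymbol{n}^{\perp}$,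 and ${}^{\ast}\mathbb{R}^{r}_{\varepsilon}(\Theta)\subset {}^{\ast}\mathbb{R}^{r}_{\varepsilon}$ is its image. The columns $\Theta^{(1)},\dots,\Theta^{(s)}$ of $\Theta$ are inhomogeneously independent over $\mathbb{Q}$ if $\Theta^{(1)},\dots,\Theta^{(s)},\boldsymbol{e}_{1},\dots,\boldsymbol{e}_{r}$ are linearly independent over $\mathbb{Q}$, where $\boldsymbol{e}_{1},\dots,\boldsymbol{e}_{r}$ is the standard basis of $\mathbb{R}^{r}$. *)

theory Defs
  imports "HOL-Analysis.Analysis" "HOL-Algebra.Module"
begin

section \<open>Ultrapowers\<close>

text \<open>A filter on \<open>nat\<close> is represented by its \<open>eventually\<close> predicate: a set \<open>A\<close> belongs to
  \<open>U\<close> iff \<open>eventually (\<lambda>k. k \<in> A) U\<close>.  A principal ultrafilter is one containing a singleton.\<close>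

definition nonprincipal_ultrafilter :: "nat filter \<Rightarrow> bool" where
  "nonprincipal_ultrafilter U \<longleftrightarrow>
     U \<noteq> bot \<and>
     (\<forall>P. eventually P U \<or> eventually (\<lambda>k. \<not> P k) U) \<and>
     (\<forall>n. \<not> eventually (\<lambda>k. k = n) U)"

definition ultra_rel :: "nat filter \<Rightarrow> ((nat \<Rightarrow> 'a) \<times> (nat \<Rightarrow> 'a)) set" where
  "ultra_rel U = {(x, y). eventually (\<lambda>k. x k = y k) U}"

definition ultra_class :: "nat filter \<Rightarrow> (nat \<Rightarrow> 'a) \<Rightarrow> (nat \<Rightarrow> 'a) set" where
  "ultra_class U x = ultra_rel U `` {x}"

definition ultra_lift :: "nat filter \<Rightarrow> ('a \<Rightarrow> 'b) \<Rightarrow> (nat \<Rightarrow> 'a) set \<Rightarrow> (nat \<Rightarrow> 'b) set" where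
  "ultra_lift U f X = (\<Union>x\<in>X. ultra_class U (\<lambda>k. f (x k)))"

definition ultra_lift2 ::
    "nat filter \<Rightarrow> ('a \<Rightarrow> 'b \<Rightarrow> 'c) \<Rightarrow> (nat \<Rightarrow> 'a) set \<Rightarrow> (nat \<Rightarrow> 'b) set \<Rightarrow> (nat \<Rightarrow> 'c) set" where
  "ultra_lift2 U f X Y = (\<Union>x\<in>X. \<Union>y\<in>Y. ultra_class U (\<lambda>k. f (x k) (y k)))"

definition ultrapower :: "nat filter \<Rightarrow> (nat \<Rightarrow> 'a::comm_ring_1) set ring" where
  "ultrapower U =
     \<lparr>carrier = UNIV // ultra_rel U,
      mult = ultra_lift2 U (*),
      one = ultra_class U (\<lambda>_. 1),
      zero = ultra_class U (\<lambda>_. 0),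
      add = ultra_lift2 U (+)\<rparr>"

abbreviation hyperint :: "nat filter \<Rightarrow> (nat \<Rightarrow> int) set ring" where
  "hyperint U \<equiv> ultrapower U"

abbreviation hyperreal :: "nat filter \<Rightarrow> (nat \<Rightarrow> real) set ring" where
  "hyperreal U \<equiv> ultrapower U"

definition hyper_std :: "nat filter \<Rightarrow> real \<Rightarrow> (nat \<Rightarrow> real) set" where
  "hyper_std U a = ultra_class U (\<lambda>_. a)"

text \<open>The inclusion of the hyperintegers into the hyperreals.\<close>

definition hyper_incl :: "nat filter \<Rightarrow> (nat \<Rightarrow> int) set \<Rightarrow> (nat \<Rightarrow> real) set" where
  "hyper_incl U = ultra_lift U real_of_int"

definition hyper_less :: "nat filter \<Rightarrow> (nat \<Rightarrow> real) set \<Rightarrow> (nat \<Rightarrow> real) set \<Rightarrow> bool" where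
  "hyper_less U X Y \<longleftrightarrow> (\<exists>x\<in>X. \<exists>y\<in>Y. eventually (\<lambda>k. x k < y k) U)"

definition infinitesimals :: "nat filter \<Rightarrow> (nat \<Rightarrow> real) set set" where
  "infinitesimals U =
     {X \<in> carrier (hyperreal U).
        \<forall>e>0. hyper_less U (hyper_std U (- e)) X \<and> hyper_less U X (hyper_std U e)}"


section \<open>Finite powers of a ring\<close>

text \<open>The product ring indexed by \<open>'n\<close>, with its module structure over the base ring.\<close>

definition vec_power :: "('a, 'm) ring_scheme \<Rightarrow> ('a, 'a ^ 'n) module" where
  "vec_power R =
     \<lparr>carrier = {v. \<forall>i. v $ i \<in> carrier R},
      mult = (\<lambda>v w. \<chi> i. v $ i \<otimes>\<^bsub>R\<^esub> w $ i),
      one = (\<chi> i. \<one>\<^bsub>R\<^esub>),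
      zero = (\<chi> i. \<zero>\<^bsub>R\<^esub>),
      add = (\<lambda>v w. \<chi> i. v $ i \<oplus>\<^bsub>R\<^esub> w $ i),
      smult = (\<lambda>a v. \<chi> i. a \<otimes>\<^bsub>R\<^esub> v $ i)\<rparr>"


section \<open>The inhomogeneous diophantine approximation group and its error map\<close>

definition hyper_matvec ::
    "nat filter \<Rightarrow> real ^ 's ^ 'r \<Rightarrow> (nat \<Rightarrow> int) set ^ 's \<Rightarrow> (nat \<Rightarrow> real) set ^ 'r" where
  "hyper_matvec U \<Theta> n =
     (\<chi> i. \<Oplus>\<^bsub>hyperreal U\<^esub>j\<in>UNIV. hyper_std U (\<Theta> $ i $ j) \<otimes>\<^bsub>hyperreal U\<^esub> hyper_incl U (n $ j))"

definition approx_diff ::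
    "nat filter \<Rightarrow> real ^ 's ^ 'r \<Rightarrow> (nat \<Rightarrow> int) set ^ 's \<Rightarrow> (nat \<Rightarrow> int) set ^ 'r
      \<Rightarrow> (nat \<Rightarrow> real) set ^ 'r" where
  "approx_diff U \<Theta> n m =
     hyper_matvec U \<Theta> n \<ominus>\<^bsub>vec_power (hyperreal U)\<^esub> (\<chi> i. hyper_incl U (m $ i))"

definition is_dual ::
    "nat filter \<Rightarrow> real ^ 's ^ 'r \<Rightarrow> (nat \<Rightarrow> int) set ^ 's \<Rightarrow> (nat \<Rightarrow> int) set ^ 'r \<Rightarrow> bool" where
  "is_dual U \<Theta> n m \<longleftrightarrow>
     m \<in> carrier (vec_power (hyperint U)) \<and> (\<forall>i. approx_diff U \<Theta> n m $ i \<in> infinitesimals U)"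

definition dioph_set :: "nat filter \<Rightarrow> real ^ 's ^ 'r \<Rightarrow> ((nat \<Rightarrow> int) set ^ 's) set" where
  "dioph_set U \<Theta> = {n \<in> carrier (vec_power (hyperint U)). \<exists>m. is_dual U \<Theta> n m}"

definition error_map ::
    "nat filter \<Rightarrow> real ^ 's ^ 'r \<Rightarrow> (nat \<Rightarrow> int) set ^ 's \<Rightarrow> (nat \<Rightarrow> real) set ^ 'r" where
  "error_map U \<Theta> n = approx_diff U \<Theta> n (THE m. is_dual U \<Theta> n m)"

text \<open>Both groups are additive; in the library's monoid records addition is the \<open>mult\<close> field.\<close>

definition dioph_group :: "nat filter \<Rightarrow> real ^ 's ^ 'r \<Rightarrow> ((nat \<Rightarrow> int) set ^ 's) monoid" where
  "dioph_group U \<Theta> =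
     \<lparr>carrier = dioph_set U \<Theta>,
      mult = add (vec_power (hyperint U)),
      one = zero (vec_power (hyperint U))\<rparr>"

definition error_group :: "nat filter \<Rightarrow> real ^ 's ^ 'r \<Rightarrow> ((nat \<Rightarrow> real) set ^ 'r) monoid" where
  "error_group U \<Theta> =
     \<lparr>carrier = error_map U \<Theta> ` dioph_set U \<Theta>,
      mult = add (vec_power (hyperreal U)),
      one = zero (vec_power (hyperreal U))\<rparr>"


section \<open>Inhomogeneous independence\<close>

interpretation rat_space: vector_space "\<lambda>(q::rat) (v::real ^ 'n). real_of_rat q *\<^sub>R v"
  by unfold_locales (simp_all add: scaleR_add_right scaleR_add_left of_rat_add of_rat_mult)

text \<open>Independence is that of the family indexed by \<open>'s + 'r\<close>, so repeated vectors make it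
  dependent; as the library notion concerns sets, injectivity is required separately.\<close>

definition inhom_family :: "real ^ 's ^ 'r \<Rightarrow> 's + 'r \<Rightarrow> real ^ 'r" where
  "inhom_family \<Theta> = case_sum (\<lambda>j. column j \<Theta>) (\<lambda>i. axis i 1)"

definition inhom_independent :: "real ^ 's ^ 'r \<Rightarrow> bool" where
  "inhom_independent \<Theta> \<longleftrightarrow>
     inj (inhom_family \<Theta>) \<and> rat_space.independent (range (inhom_family \<Theta>))"


section \<open>Well-definedness: operations on representatives, uniqueness of the dual, group structure\<close>

lemma equiv_ultra_rel: "equiv UNIV (ultra_rel U)"
  by (intro equivI refl_onI symI transI)
     (auto simp: ultra_rel_def eq_commute elim: eventually_elim2)

lemma mem_ultra_class: "y \<in> ultra_class U x \<longleftrightarrow> eventually (\<lambda>k. x k = y k) U"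
  by (simp add: ultra_class_def ultra_rel_def)

lemma ultra_class_eq_iff: "ultra_class U x = ultra_class U y \<longleftrightarrow> eventually (\<lambda>k. x k = y k) U"
  using eq_equiv_class_iff[OF equiv_ultra_rel, of x y U] by (simp add: ultra_class_def ultra_rel_def)

lemma ultra_lift_class: "ultra_lift U f (ultra_class U x) = ultra_class U (\<lambda>k. f (x k))"
proof -
  have "ultra_class U (\<lambda>k. f (x' k)) = ultra_class U (\<lambda>k. f (x k))" if "x' \<in> ultra_class U x" for x'
    using that unfolding mem_ultra_class ultra_class_eq_iff by (auto elim: eventually_mono)
  moreover have "x \<in> ultra_class U x" by (simp add: mem_ultra_class)
  ultimately show ?thesis unfolding ultra_lift_def by blast
qed

lemma ultra_lift2_class:
  "ultra_lift2 U f (ultra_class U x) (ultra_class U y) = ultra_class U (\<lambda>k. f (x k) (y k))"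
proof -
  have "ultra_class U (\<lambda>k. f (x' k) (y' k)) = ultra_class U (\<lambda>k. f (x k) (y k))"
    if "x' \<in> ultra_class U x" "y' \<in> ultra_class U y" for x' y'
    using that unfolding mem_ultra_class ultra_class_eq_iff by (auto elim: eventually_elim2)
  moreover have "x \<in> ultra_class U x" "y \<in> ultra_class U y" by (simp_all add: mem_ultra_class)
  ultimately show ?thesis unfolding ultra_lift2_def by blast
qed

lemma carrier_ultrapower: "carrier (ultrapower U) = range (ultra_class U)"
  by (auto simp: ultrapower_def quotient_def ultra_class_def)

lemma hyper_less_class:
  "hyper_less U (ultra_class U x) (ultra_class U y) \<longleftrightarrow> eventually (\<lambda>k. x k < y k) U"
proof
  assume "hyper_less U (ultra_class U x) (ultra_class U y)"
  then obtain x' y' where "eventually (\<lambda>k. x k = x' k) U" "eventually (\<lambda>k. y k = y' k) U"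
    "eventually (\<lambda>k. x' k < y' k) U" by (auto simp: hyper_less_def mem_ultra_class)
  then show "eventually (\<lambda>k. x k < y k) U" by eventually_elim simp
next
  assume "eventually (\<lambda>k. x k < y k) U"
  moreover have "x \<in> ultra_class U x" "y \<in> ultra_class U y" by (simp_all add: mem_ultra_class)
  ultimately show "hyper_less U (ultra_class U x) (ultra_class U y)" unfolding hyper_less_def by blast
qed

lemma infinitesimal_class:
  "ultra_class U x \<in> infinitesimals U \<longleftrightarrow> (x \<longlongrightarrow> 0) U"
proof -
  have "(\<bar>a\<bar> < e) = (- e < a \<and> a < e)" for a e :: real by auto
  then show ?thesis
    by (simp add: infinitesimals_def carrier_ultrapower hyper_std_def hyper_less_class
        tendsto_iff eventually_conj_iff)
qed

lemma cring_ultrapower: "cring (ultrapower U)"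
proof (rule cringI)
  show "abelian_group (ultrapower U)"
  proof (rule abelian_groupI)
    fix x assume "x \<in> carrier (ultrapower U)"
    then obtain a where "x = ultra_class U a" by (auto simp: carrier_ultrapower)
    then show "\<exists>y\<in>carrier (ultrapower U). y \<oplus>\<^bsub>ultrapower U\<^esub> x = \<zero>\<^bsub>ultrapower U\<^esub>"
      by (intro bexI[of _ "ultra_class U (\<lambda>k. - a k)"])
         (simp_all add: carrier_ultrapower, simp add: ultrapower_def ultra_lift2_class)
  qed (auto simp: carrier_ultrapower, auto simp: ultrapower_def ultra_lift2_class algebra_simps)
  show "comm_monoid (ultrapower U)"
    by (rule comm_monoidI)
       (auto simp: carrier_ultrapower, auto simp: ultrapower_def ultra_lift2_class algebra_simps)
qed (auto simp: carrier_ultrapower, auto simp: ultrapower_def ultra_lift2_class algebra_simps)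

lemma module_vec_power:
  assumes "cring R" shows "module R (vec_power R)"
proof -
  interpret cring R by fact
  show ?thesis
  proof (rule moduleI[OF assms])
    show "abelian_group (vec_power R)"
    proof (rule abelian_groupI)
      fix x assume "x \<in> carrier (vec_power R)"
      then show "\<exists>y\<in>carrier (vec_power R). y \<oplus>\<^bsub>vec_power R\<^esub> x = \<zero>\<^bsub>vec_power R\<^esub>"
        by (intro bexI[of _ "\<chi> i. \<ominus>\<^bsub>R\<^esub> x $ i"]) (auto simp: vec_power_def vec_eq_iff l_neg)
    qed (auto simp: vec_power_def vec_eq_iff a_ac)
  qed (auto simp: vec_power_def vec_eq_iff l_distr r_distr m_ac)
qed

lemma vec_power_minus:
  assumes "cring R" "v \<in> carrier (vec_power R)" "w \<in> carrier (vec_power R)"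
  shows "v \<ominus>\<^bsub>vec_power R\<^esub> w = (\<chi> i. v $ i \<ominus>\<^bsub>R\<^esub> w $ i)"
proof -
  interpret cring R by fact
  interpret M: module R "vec_power R" by (rule module_vec_power) fact
  have "\<ominus>\<^bsub>vec_power R\<^esub> w = (\<chi> i. \<ominus>\<^bsub>R\<^esub> w $ i)"
    using assms(3) by (intro M.minus_equality) (auto simp: vec_power_def vec_eq_iff l_neg)
  then show ?thesis by (simp add: a_minus_def) (simp add: vec_power_def)
qed

lemma ultrapower_minus:
  "ultra_class U x \<ominus>\<^bsub>ultrapower U\<^esub> ultra_class U y = ultra_class U (\<lambda>k. x k - y k)"
proof -
  interpret cring "ultrapower U" by (rule cring_ultrapower)
  have "\<ominus>\<^bsub>ultrapower U\<^esub> ultra_class U y = ultra_class U (\<lambda>k. - y k)"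
    by (intro minus_equality) (simp_all add: carrier_ultrapower, simp add: ultrapower_def ultra_lift2_class)
  then show ?thesis by (simp add: a_minus_def) (simp add: ultrapower_def ultra_lift2_class)
qed

lemma ultrapower_finsum:
  assumes "finite A"
  shows "(\<Oplus>\<^bsub>ultrapower U\<^esub>j\<in>A. ultra_class U (x j)) = ultra_class U (\<lambda>k. \<Sum>j\<in>A. x j k)"
proof -
  interpret cring "ultrapower U" by (rule cring_ultrapower)
  show ?thesis using assms
  proof induction
    case empty show ?case by simp (simp add: ultrapower_def)
  next
    case (insert a A)
    have "(\<Oplus>\<^bsub>ultrapower U\<^esub>j\<in>insert a A. ultra_class U (x j)) =
        ultra_class U (x a) \<oplus>\<^bsub>ultrapower U\<^esub> (\<Oplus>\<^bsub>ultrapower U\<^esub>j\<in>A. ultra_class U (x j))"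
      using insert.hyps by (intro finsum_insert) (auto simp: carrier_ultrapower)
    also have "\<dots> = ultra_class U (x a) \<oplus>\<^bsub>ultrapower U\<^esub> ultra_class U (\<lambda>k. \<Sum>j\<in>A. x j k)"
      by (simp only: insert.IH)
    also have "\<dots> = ultra_class U (\<lambda>k. x a k + (\<Sum>j\<in>A. x j k))"
      by (simp add: ultrapower_def ultra_lift2_class)
    finally show ?case using insert.hyps by simp
  qed
qed

lemma hyper_matvec_class:
  "hyper_matvec U \<Theta> (\<chi> j. ultra_class U (n j)) $ i =
     ultra_class U (\<lambda>k. \<Sum>j\<in>UNIV. \<Theta> $ i $ j * real_of_int (n j k))"
proof -
  have "ultra_class U a \<otimes>\<^bsub>ultrapower U\<^esub> ultra_class U b = ultra_class U (\<lambda>k. a k * b k)"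
    for a b :: "nat \<Rightarrow> real" by (simp add: ultrapower_def ultra_lift2_class)
  then show ?thesis
    by (simp add: hyper_matvec_def hyper_std_def hyper_incl_def ultra_lift_class ultrapower_finsum)
qed

lemma approx_diff_class:
  "approx_diff U \<Theta> (\<chi> j. ultra_class U (n j)) (\<chi> i. ultra_class U (m i)) $ i =
     ultra_class U (\<lambda>k. (\<Sum>j\<in>UNIV. \<Theta> $ i $ j * real_of_int (n j k)) - real_of_int (m i k))"
  unfolding approx_diff_def
  by (subst vec_power_minus[OF cring_ultrapower])
     (auto simp: hyper_matvec_class ultrapower_minus hyper_incl_def ultra_lift_class
        vec_power_def carrier_ultrapower)

lemma vec_classE:
  assumes "v \<in> carrier (vec_power (ultrapower U))"
  obtains n where "v = (\<chi> j. ultra_class U (n j))"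
proof -
  have "\<exists>n. v $ j = ultra_class U n" for j
    using assms by (auto simp: vec_power_def carrier_ultrapower)
  then obtain n where "\<And>j. v $ j = ultra_class U (n j)" by metis
  then show ?thesis by (intro that[of n]) (simp add: vec_eq_iff)
qed

lemma is_dual_class:
  "is_dual U \<Theta> (\<chi> j. ultra_class U (n j)) (\<chi> i. ultra_class U (m i)) \<longleftrightarrow>
   (\<forall>i. ((\<lambda>k. (\<Sum>j\<in>UNIV. \<Theta> $ i $ j * real_of_int (n j k)) - real_of_int (m i k)) \<longlongrightarrow> 0) U)"
  by (simp add: is_dual_def approx_diff_class infinitesimal_class)
     (simp add: vec_power_def carrier_ultrapower)

lemma is_dual_unique:
  assumes "n \<in> carrier (vec_power (hyperint U))" "is_dual U \<Theta> n m" "is_dual U \<Theta> n m'"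
  shows "m = m'"
proof -
  obtain n' where n: "n = (\<chi> j. ultra_class U (n' j))" using assms(1) by (rule vec_classE)
  obtain a where m: "m = (\<chi> j. ultra_class U (a j))"
    using assms(2) unfolding is_dual_def by (blast elim: vec_classE)
  obtain b where m': "m' = (\<chi> j. ultra_class U (b j))"
    using assms(3) unfolding is_dual_def by (blast elim: vec_classE)
  have "eventually (\<lambda>k. a i k = b i k) U" for i
  proof -
    let ?L = "\<lambda>k. \<Sum>j\<in>UNIV. \<Theta> $ i $ j * real_of_int (n' j k)"
    have "((\<lambda>k. (?L k - real_of_int (b i k)) - (?L k - real_of_int (a i k))) \<longlongrightarrow> 0 - 0) U"
      using assms(2,3) unfolding n m m' is_dual_class by (intro tendsto_diff) auto
    then have "eventually (\<lambda>k. dist ((?L k - real_of_int (b i k)) - (?L k - real_of_int (a i k))) 0 < 1) U"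
      by (intro tendstoD) auto
    then show ?thesis by eventually_elim (auto simp: dist_real_def)
  qed
  then show ?thesis unfolding m m' by (simp add: vec_eq_iff ultra_class_eq_iff)
qed

lemma error_map_eq:
  assumes "n \<in> carrier (vec_power (hyperint U))" "is_dual U \<Theta> n m"
  shows "error_map U \<Theta> n = approx_diff U \<Theta> n m"
proof -
  have "(THE m. is_dual U \<Theta> n m) = m"
    using assms is_dual_unique by blast
  then show ?thesis by (simp add: error_map_def)
qed

lemma dioph_setE:
  assumes "n \<in> dioph_set U \<Theta>"
  obtains a b where "n = (\<chi> j. ultra_class U (a j))" "is_dual U \<Theta> n (\<chi> i. ultra_class U (b i))"
proof -
  obtain m where n: "n \<in> carrier (vec_power (hyperint U))" and m: "is_dual U \<Theta> n m"
    using assms unfolding dioph_set_def by blast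
  from n obtain a where "n = (\<chi> j. ultra_class U (a j))" by (rule vec_classE)
  moreover from m have "m \<in> carrier (vec_power (hyperint U))" by (simp add: is_dual_def)
  then obtain b where "m = (\<chi> j. ultra_class U (b j))" by (rule vec_classE)
  ultimately show ?thesis using that m by blast
qed

lemma dioph_add:
  fixes \<Theta> :: "real ^ 's ^ 'r"
  assumes "n \<in> dioph_set U \<Theta>" "n' \<in> dioph_set U \<Theta>"
  shows "n \<oplus>\<^bsub>vec_power (hyperint U)\<^esub> n' \<in> dioph_set U \<Theta>"
    and "error_map U \<Theta> (n \<oplus>\<^bsub>vec_power (hyperint U)\<^esub> n') =
         error_map U \<Theta> n \<oplus>\<^bsub>vec_power (hyperreal U)\<^esub> error_map U \<Theta> n'"
proof -
  obtain a b where a: "n = (\<chi> j. ultra_class U (a j))"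
    and b: "is_dual U \<Theta> n (\<chi> i. ultra_class U (b i))" using assms(1) by (rule dioph_setE)
  obtain a' b' where a': "n' = (\<chi> j. ultra_class U (a' j))"
    and b': "is_dual U \<Theta> n' (\<chi> i. ultra_class U (b' i))" using assms(2) by (rule dioph_setE)
  let ?n = "\<chi> j. ultra_class U (\<lambda>k. a j k + a' j k)"
  let ?m = "\<chi> j. ultra_class U (\<lambda>k. b j k + b' j k)"
  have sum: "n \<oplus>\<^bsub>vec_power (hyperint U)\<^esub> n' = ?n"
    by (simp add: a a' vec_power_def ultrapower_def ultra_lift2_class)
  have c: "?n \<in> carrier (vec_power (hyperint U))" by (simp add: vec_power_def carrier_ultrapower)
  have d: "is_dual U \<Theta> ?n ?m"
    unfolding is_dual_class
  proof
    fix i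
    from b b' have "((\<lambda>k. ((\<Sum>j\<in>UNIV. \<Theta> $ i $ j * real_of_int (a j k)) - real_of_int (b i k)) +
       ((\<Sum>j\<in>UNIV. \<Theta> $ i $ j * real_of_int (a' j k)) - real_of_int (b' i k))) \<longlongrightarrow> 0 + 0) U"
      unfolding a a' is_dual_class by (intro tendsto_add) auto
    then show "((\<lambda>k. (\<Sum>j\<in>UNIV. \<Theta> $ i $ j * real_of_int (a j k + a' j k)) -
       real_of_int (b i k + b' i k)) \<longlongrightarrow> 0) U"
      by (simp add: algebra_simps sum.distrib)
  qed
  show "n \<oplus>\<^bsub>vec_power (hyperint U)\<^esub> n' \<in> dioph_set U \<Theta>"
    unfolding dioph_set_def sum using c d by blast
  have "n \<in> carrier (vec_power (hyperint U))" "n' \<in> carrier (vec_power (hyperint U))"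
    using assms by (auto simp: dioph_set_def)
  then show "error_map U \<Theta> (n \<oplus>\<^bsub>vec_power (hyperint U)\<^esub> n') =
         error_map U \<Theta> n \<oplus>\<^bsub>vec_power (hyperreal U)\<^esub> error_map U \<Theta> n'"
    unfolding sum error_map_eq[OF c d]
    by (simp add: error_map_eq[OF _ b] error_map_eq[OF _ b'])
       (simp add: vec_eq_iff a a' approx_diff_class vec_power_def ultrapower_def ultra_lift2_class
          algebra_simps sum.distrib)
qed

lemma dioph_subgroup:
  "subgroup (dioph_set U \<Theta>) (add_monoid (vec_power (hyperint U)))"
proof -
  interpret M: module "hyperint U" "vec_power (hyperint U)"
    by (rule module_vec_power[OF cring_ultrapower])
  show ?thesis
  proof (rule M.add.subgroupI)
    show "dioph_set U \<Theta> \<subseteq> carrier (vec_power (hyperint U))" by (auto simp: dioph_set_def)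
    have "is_dual U \<Theta> (\<chi> j. ultra_class U (\<lambda>_. 0)) (\<chi> i. ultra_class U (\<lambda>_. 0))"
      by (subst is_dual_class) simp
    moreover have "(\<chi> j. ultra_class U (\<lambda>_. 0)) \<in> carrier (vec_power (hyperint U))"
      by (simp add: vec_power_def carrier_ultrapower)
    ultimately show "dioph_set U \<Theta> \<noteq> {}" unfolding dioph_set_def by blast
  next
    fix n assume "n \<in> dioph_set U \<Theta>"
    then obtain a b where a: "n = (\<chi> j. ultra_class U (a j))"
      and b: "is_dual U \<Theta> n (\<chi> i. ultra_class U (b i))" by (rule dioph_setE)
    let ?n = "\<chi> j. ultra_class U (\<lambda>k. - a j k)"
    have c: "?n \<in> carrier (vec_power (hyperint U))" by (simp add: vec_power_def carrier_ultrapower)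
    have "\<ominus>\<^bsub>vec_power (hyperint U)\<^esub> n = ?n"
    proof (rule M.minus_equality)
      show "?n \<oplus>\<^bsub>vec_power (hyperint U)\<^esub> n = \<zero>\<^bsub>vec_power (hyperint U)\<^esub>"
        by (simp add: a vec_power_def ultrapower_def ultra_lift2_class)
      show "n \<in> carrier (vec_power (hyperint U))"
        by (simp add: a vec_power_def carrier_ultrapower)
    qed (rule c)
    moreover have "is_dual U \<Theta> ?n (\<chi> i. ultra_class U (\<lambda>k. - b i k))"
      unfolding is_dual_class
    proof
      fix i
      from b have "((\<lambda>k. - ((\<Sum>j\<in>UNIV. \<Theta> $ i $ j * real_of_int (a j k)) - real_of_int (b i k))) \<longlongrightarrow> - 0) U"
        unfolding a is_dual_class by (intro tendsto_minus) auto
      then show "((\<lambda>k. (\<Sum>j\<in>UNIV. \<Theta> $ i $ j * real_of_int (- a j k)) - real_of_int (- b i k)) \<longlongrightarrow> 0) U"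
        by (simp add: algebra_simps sum_negf)
    qed
    ultimately show "\<ominus>\<^bsub>vec_power (hyperint U)\<^esub> n \<in> dioph_set U \<Theta>"
      using c unfolding dioph_set_def by auto
  next
    fix n n' assume "n \<in> dioph_set U \<Theta>" "n' \<in> dioph_set U \<Theta>"
    then show "n \<oplus>\<^bsub>vec_power (hyperint U)\<^esub> n' \<in> dioph_set U \<Theta>"
      by (rule dioph_add(1))
  qed
qed

lemma group_dioph_group: "group (dioph_group U \<Theta>)"
proof -
  interpret M: module "hyperint U" "vec_power (hyperint U)"
    by (rule module_vec_power[OF cring_ultrapower])
  show ?thesis
    using M.add.subgroup_imp_group[OF dioph_subgroup[of U \<Theta>]]
    unfolding dioph_group_def group_def group_axioms_def monoid_def Units_def by simp
qed

end

theory Submission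
  imports Defs
begin

text \<open>
  All three conditions say that \<open>\<Theta>\<close> has no integer relation: no nonzero standard vector
  \<open>a \<in> \<int>\<^sup>s\<close> with \<open>\<Theta> a \<in> \<int>\<^sup>r\<close>.

  For (1), a rational dependence among the columns and the standard basis becomes an integer
  relation once its denominators are cleared; the coefficients of the columns cannot all vanish,
  because the basis vectors are independent by themselves.

  For (2), the error map is a homomorphism onto its image, so only injectivity is in question.  Two
  hyperinteger vectors with equal errors are represented by integer sequences \<open>a\<close>, \<open>a'\<close> such that
  \<open>\<Theta> (a k - a' k)\<close> is integral for almost all \<open>k\<close>; if the vectors differ, a single such index \<open>k\<close>
  yields a standard integer relation.

  For (3), the hyperinteger multiples of an integer relation form a nonzero ideal inside the
  approximation group.  Conversely, if all multiples of a vector \<open>n\<close> lie in the group then the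
  error of \<open>n\<close> vanishes: a nonzero infinitesimal coordinate of the error could be stretched by a
  hyperinteger to a quantity infinitely close to \<open>1 / 2\<close>, which keeps away from every hyperinteger.
  So a nonzero ideal contains a nonzero \<open>n\<close> with the same error as \<open>0\<close>, contradicting injectivity.
\<close>

definition has_integer_relation :: "real ^ 's ^ 'r \<Rightarrow> bool" where
  "has_integer_relation \<Theta> \<longleftrightarrow>
     (\<exists>a :: 's \<Rightarrow> int. (\<exists>j. a j \<noteq> 0) \<and> (\<forall>i. (\<Sum>j\<in>UNIV. \<Theta> $ i $ j * real_of_int (a j)) \<in> \<int>))"


section \<open>Rational independence and integer relations\<close>

text \<open>Independence of a finite family, as opposed to that of its range: a repeated vector shows up as
  the coefficients \<open>1\<close> and \<open>-1\<close> at two indices.\<close>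

lemma (in vector_space) inj_independent_range_iff:
  fixes f :: "'i::finite \<Rightarrow> 'b"
  shows "inj f \<and> independent (range f) \<longleftrightarrow>
    (\<forall>c. (\<Sum>x\<in>UNIV. scale (c x) (f x)) = 0 \<longrightarrow> (\<forall>x. c x = 0))"
proof (intro iffI conjI allI impI)
  fix c x
  assume "inj f \<and> independent (range f)" and sum: "(\<Sum>x\<in>UNIV. scale (c x) (f x)) = 0"
  then have inj: "inj f" and ind: "independent (range f)" by auto
  have "(\<Sum>v\<in>range f. scale (c (inv_into UNIV f v)) v) = (\<Sum>x\<in>UNIV. scale (c x) (f x))"
    using inj by (simp add: sum.reindex)
  then have "c (inv_into UNIV f (f x)) = 0"
    using ind sum by (auto simp: dependent_finite)
  then show "c x = 0" using inj by simp
next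
  assume triv: "\<forall>c. (\<Sum>x\<in>UNIV. scale (c x) (f x)) = 0 \<longrightarrow> (\<forall>x. c x = 0)"
  show inj: "inj f"
  proof (rule injI, rule ccontr)
    fix x y assume eq: "f x = f y" and ne: "x \<noteq> y"
    let ?c = "\<lambda>z. (if z = x then 1 else 0) - (if z = y then 1 else 0) :: 'a"
    have "scale (?c z) (f z) = (if z = x then f x else 0) - (if z = y then f y else 0)" for z
      by (simp add: scale_left_diff_distrib)
    then have "(\<Sum>z\<in>UNIV. scale (?c z) (f z)) = f x - f y"
      by (simp add: sum_subtractf)
    then have "?c x = 0" using triv[rule_format, of ?c x] eq by simp
    then show False using ne by simp
  qed
  show "independent (range f)"
  proof
    assume "dependent (range f)"
    then obtain u x where "u (f x) \<noteq> 0" and u: "(\<Sum>v\<in>range f. scale (u v) v) = 0"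
      by (auto simp: dependent_finite)
    moreover have "(\<Sum>v\<in>range f. scale (u v) v) = (\<Sum>x\<in>UNIV. scale (u (f x)) (f x))"
      using inj by (simp add: sum.reindex)
    ultimately show False using triv by auto
  qed
qed

lemma common_denominator:
  fixes c :: "'i \<Rightarrow> rat"
  assumes "finite S"
  obtains D :: int where "D > 0" "\<And>x. x \<in> S \<Longrightarrow> of_int D * c x \<in> \<int>"
proof -
  have "\<exists>D::int. D > 0 \<and> (\<forall>x\<in>S. of_int D * c x \<in> \<int>)"
    using assms
  proof induction
    case empty
    show ?case by (intro exI[of _ 1]) simp
  next
    case (insert x S)
    then obtain D :: int where D: "D > 0" "\<forall>y\<in>S. of_int D * c y \<in> \<int>" by blast
    obtain p q where pq: "c x = of_int p / of_int q" "q > 0"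
      by (metis Fract_of_int_quotient Rat_cases)
    have "of_int (D * q) * c x \<in> \<int>" using pq by simp
    moreover have "of_int (D * q) * c y \<in> \<int>" if "y \<in> S" for y
    proof -
      have "of_int q * (of_int D * c y) \<in> \<int>" by (rule Ints_mult[OF Ints_of_int]) (use D(2) that in blast)
      then show ?thesis by (simp add: mult_ac)
    qed
    ultimately show ?case using D(1) pq(2) by (intro exI[of _ "D * q"]) auto
  qed
  then show thesis using that by blast
qed

lemma inhom_combination_nth:
  fixes \<Theta> :: "real ^ 's ^ 'r"
  shows "(\<Sum>x\<in>UNIV. real_of_rat (c x) *\<^sub>R inhom_family \<Theta> x) $ i =
    (\<Sum>j\<in>UNIV. \<Theta> $ i $ j * real_of_rat (c (Inl j))) + real_of_rat (c (Inr i))"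
proof -
  have *: "(\<Sum>l\<in>UNIV. real_of_rat (c (Inr l)) * axis l 1 $ i) = real_of_rat (c (Inr i))"
    by (subst sum.cong[OF refl, where h = "\<lambda>l. if l = i then real_of_rat (c (Inr l)) else 0"])
       (auto simp: axis_def)
  have "(\<Sum>x\<in>UNIV. real_of_rat (c x) *\<^sub>R inhom_family \<Theta> x) $ i =
      (\<Sum>x\<in>UNIV <+> UNIV. real_of_rat (c x) * inhom_family \<Theta> x $ i)"
    by (simp add: UNIV_Plus_UNIV)
  also have "\<dots> = (\<Sum>j\<in>UNIV. \<Theta> $ i $ j * real_of_rat (c (Inl j))) + real_of_rat (c (Inr i))"
    by (subst sum.Plus) (auto simp: inhom_family_def column_def * mult.commute)
  finally show ?thesis .
qed

lemma inhom_independent_iff: "inhom_independent \<Theta> \<longleftrightarrow> \<not> has_integer_relation \<Theta>"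
proof -
  let ?comb = "\<lambda>c. \<Sum>x\<in>UNIV. real_of_rat (c x) *\<^sub>R inhom_family \<Theta> x"
  have "(\<exists>c. ?comb c = 0 \<and> (\<exists>x. c x \<noteq> 0)) \<longleftrightarrow> has_integer_relation \<Theta>"
  proof
    assume "\<exists>c. ?comb c = 0 \<and> (\<exists>x. c x \<noteq> 0)"
    then obtain c x where "?comb c = 0" and x: "c x \<noteq> 0" by blast
    then have c: "(\<Sum>j\<in>UNIV. \<Theta> $ i $ j * real_of_rat (c (Inl j))) + real_of_rat (c (Inr i)) = 0" for i
      using inhom_combination_nth[of c \<Theta> i] by simp
    \<comment> \<open>If all column coefficients vanished, row \<open>i\<close> of the dependence would read \<open>c (Inr i) = 0\<close>.\<close>
    obtain j0 where j0: "c (Inl j0) \<noteq> 0"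
    proof (cases "\<exists>j. c (Inl j) \<noteq> 0")
      case False
      then have "c (Inl j) = 0" "c (Inr i) = 0" for i j using c[of i] by auto
      then have "c x = 0" by (cases x) auto
      then show ?thesis using x by simp
    qed (use that in blast)
    obtain D :: int where D: "D > 0" "\<And>x. of_int D * c x \<in> \<int>"
      using common_denominator[of UNIV c] by auto
    have "\<exists>z. of_int D * c x = of_int z" for x
      using D(2)[of x] by (auto elim: Ints_cases)
    then obtain z where z: "\<And>x. of_int D * c x = of_int (z x)" by metis
    have zr: "real_of_int D * real_of_rat (c x) = real_of_int (z x)" for x
      using arg_cong[OF z[of x], of real_of_rat] by (simp add: of_rat_mult)
    have "(\<Sum>j\<in>UNIV. \<Theta> $ i $ j * real_of_int (z (Inl j))) = - real_of_int (z (Inr i))" for i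
    proof -
      have "(\<Sum>j\<in>UNIV. \<Theta> $ i $ j * real_of_int (z (Inl j))) + real_of_int (z (Inr i)) =
        real_of_int D * ((\<Sum>j\<in>UNIV. \<Theta> $ i $ j * real_of_rat (c (Inl j))) + real_of_rat (c (Inr i)))"
        by (simp add: zr[symmetric] distrib_left sum_distrib_left mult_ac)
      then show ?thesis using c[of i] by simp
    qed
    moreover have "z (Inl j0) \<noteq> 0" using z[of "Inl j0"] j0 D(1) by auto
    ultimately show "has_integer_relation \<Theta>"
      unfolding has_integer_relation_def by (intro exI[of _ "\<lambda>j. z (Inl j)"]) auto
  next
    assume "has_integer_relation \<Theta>"
    then obtain a j0 where j0: "a j0 \<noteq> 0"
      and a: "\<And>i. (\<Sum>j\<in>UNIV. \<Theta> $ i $ j * real_of_int (a j)) \<in> \<int>"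
      unfolding has_integer_relation_def by blast
    have "\<exists>b. (\<Sum>j\<in>UNIV. \<Theta> $ i $ j * real_of_int (a j)) = real_of_int b" for i
      using a[of i] by (auto elim: Ints_cases)
    then obtain b where b: "\<And>i. (\<Sum>j\<in>UNIV. \<Theta> $ i $ j * real_of_int (a j)) = real_of_int (b i)"
      by metis
    define c :: "_ \<Rightarrow> rat" where "c = case_sum (\<lambda>j. of_int (a j)) (\<lambda>i. - of_int (b i))"
    have "?comb c = 0"
      unfolding vec_eq_iff inhom_combination_nth by (simp add: c_def b of_rat_minus)
    moreover have "c (Inl j0) \<noteq> 0" using j0 by (simp add: c_def)
    ultimately show "\<exists>c. ?comb c = 0 \<and> (\<exists>x. c x \<noteq> 0)" by blast
  qed
  then show ?thesis
    unfolding inhom_independent_def rat_space.inj_independent_range_iff by blast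
qed


section \<open>Injectivity of the error map\<close>

lemma nonprincipal_ultrafilter_not_eventually:
  assumes "nonprincipal_ultrafilter U" "\<not> eventually P U"
  shows "eventually (\<lambda>k. \<not> P k) U"
  using assms unfolding nonprincipal_ultrafilter_def by blast

lemma error_map_iso_iff_inj:
  "error_map U \<Theta> \<in> iso (dioph_group U \<Theta>) (error_group U \<Theta>) \<longleftrightarrow> inj_on (error_map U \<Theta>) (dioph_set U \<Theta>)"
  by (auto simp: iso_def hom_def bij_betw_def dioph_group_def error_group_def dioph_add(2))

text \<open>The identity \<open>\<Theta> a = b\<close> between standard vectors survives multiplication by an arbitrary
  hyperinteger \<open>l\<close>: the vector \<open>l b\<close> is the dual of \<open>l a\<close>, with no error at all, no matter how
  large \<open>l\<close> is.  This both defeats injectivity and provides an ideal.\<close>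

lemma integer_relation_multiple:
  fixes U :: "nat filter" and \<Theta> :: "real ^ 's ^ 'r" and a :: "'s \<Rightarrow> int" and l :: "nat \<Rightarrow> int"
  assumes "\<And>i. (\<Sum>j\<in>UNIV. \<Theta> $ i $ j * real_of_int (a j)) \<in> \<int>"
  defines "n \<equiv> \<chi> j. ultra_class U (\<lambda>k. l k * a j)"
  shows "n \<in> dioph_set U \<Theta>" and "error_map U \<Theta> n = (\<chi> i. ultra_class U (\<lambda>k. 0))"
proof -
  have "\<exists>b. (\<Sum>j\<in>UNIV. \<Theta> $ i $ j * real_of_int (a j)) = real_of_int b" for i
    using assms(1)[of i] by (auto elim: Ints_cases)
  then obtain b where b: "\<And>i. (\<Sum>j\<in>UNIV. \<Theta> $ i $ j * real_of_int (a j)) = real_of_int (b i)"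
    by metis
  have zero: "(\<Sum>j\<in>UNIV. \<Theta> $ i $ j * real_of_int (l k * a j)) - real_of_int (l k * b i) = 0" for i k
    by (simp add: b[symmetric] sum_distrib_left mult_ac)
  have c: "n \<in> carrier (vec_power (hyperint U))"
    by (simp add: n_def vec_power_def carrier_ultrapower)
  have d: "is_dual U \<Theta> n (\<chi> i. ultra_class U (\<lambda>k. l k * b i))"
    unfolding n_def is_dual_class zero by simp
  show "n \<in> dioph_set U \<Theta>" using c d unfolding dioph_set_def by blast
  show "error_map U \<Theta> n = (\<chi> i. ultra_class U (\<lambda>k. 0))"
    unfolding error_map_eq[OF c d] unfolding n_def vec_eq_iff approx_diff_class zero by simp
qed

text \<open>An equality of errors is an equality of real sequences on a set of the ultrafilter, so it can be
  read off index by index.  This is how a nonstandard coincidence yields a standard relation.\<close>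

lemma inj_error_map_iff:
  fixes \<Theta> :: "real ^ 's ^ 'r"
  assumes U: "nonprincipal_ultrafilter U"
  shows "inj_on (error_map U \<Theta>) (dioph_set U \<Theta>) \<longleftrightarrow> \<not> has_integer_relation \<Theta>"
proof
  assume inj: "inj_on (error_map U \<Theta>) (dioph_set U \<Theta>)"
  show "\<not> has_integer_relation \<Theta>"
  proof
    assume "has_integer_relation \<Theta>"
    then obtain a :: "'s \<Rightarrow> int" and j0 where j0: "a j0 \<noteq> 0"
      and a: "\<And>i. (\<Sum>j\<in>UNIV. \<Theta> $ i $ j * real_of_int (a j)) \<in> \<int>"
      unfolding has_integer_relation_def by blast
    \<comment> \<open>The relation and the zero vector are the multiples of \<open>a\<close> by \<open>1\<close> and \<open>0\<close>.\<close>
    have "(\<chi> j. ultra_class U (\<lambda>k. 1 * a j)) = (\<chi> j. ultra_class U (\<lambda>k. 0 * a j))"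
      by (rule inj_onD[OF inj]) (simp_all only: integer_relation_multiple[OF a])
    then have "eventually (\<lambda>k. a j0 = 0) U"
      by (simp add: vec_eq_iff ultra_class_eq_iff)
    then show False using j0 U by (simp add: nonprincipal_ultrafilter_def)
  qed
next
  assume norel: "\<not> has_integer_relation \<Theta>"
  show "inj_on (error_map U \<Theta>) (dioph_set U \<Theta>)"
  proof (rule inj_onI)
    fix n n' assume n: "n \<in> dioph_set U \<Theta>" and n': "n' \<in> dioph_set U \<Theta>"
      and eq: "error_map U \<Theta> n = error_map U \<Theta> n'"
    obtain a b where a: "n = (\<chi> j. ultra_class U (a j))"
      and b: "is_dual U \<Theta> n (\<chi> i. ultra_class U (b i))" using n by (rule dioph_setE)
    obtain a' b' where a': "n' = (\<chi> j. ultra_class U (a' j))"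
      and b': "is_dual U \<Theta> n' (\<chi> i. ultra_class U (b' i))" using n' by (rule dioph_setE)
    have "n \<in> carrier (vec_power (hyperint U))" "n' \<in> carrier (vec_power (hyperint U))"
      using n n' by (auto simp: dioph_set_def)
    then have "approx_diff U \<Theta> n (\<chi> i. ultra_class U (b i)) =
        approx_diff U \<Theta> n' (\<chi> i. ultra_class U (b' i))"
      using eq by (simp add: error_map_eq[OF _ b] error_map_eq[OF _ b'])
    then have "\<forall>i. eventually (\<lambda>k. (\<Sum>j\<in>UNIV. \<Theta> $ i $ j * real_of_int (a j k)) - real_of_int (b i k) =
        (\<Sum>j\<in>UNIV. \<Theta> $ i $ j * real_of_int (a' j k)) - real_of_int (b' i k)) U"
      unfolding a a' vec_eq_iff approx_diff_class ultra_class_eq_iff .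
    then have ev: "eventually (\<lambda>k. \<forall>i. (\<Sum>j\<in>UNIV. \<Theta> $ i $ j * real_of_int (a j k)) - real_of_int (b i k) =
        (\<Sum>j\<in>UNIV. \<Theta> $ i $ j * real_of_int (a' j k)) - real_of_int (b' i k)) U"
      by (simp add: eventually_all_finite)
    have "eventually (\<lambda>k. a j0 k = a' j0 k) U" for j0
      using ev
    proof eventually_elim
      case (elim k)
      have "(\<Sum>j\<in>UNIV. \<Theta> $ i $ j * real_of_int (a j k - a' j k)) = real_of_int (b i k - b' i k)" for i
        using spec[OF elim, of i] by (simp add: right_diff_distrib sum_subtractf)
      then have "(\<Sum>j\<in>UNIV. \<Theta> $ i $ j * real_of_int (a j k - a' j k)) \<in> \<int>" for i
        by simp
      then have "a j0 k - a' j0 k = 0"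
        using norel[unfolded has_integer_relation_def not_ex, THEN spec, of "\<lambda>j. a j k - a' j k"]
        by blast
      then show ?case by simp
    qed
    then show "n = n'" by (simp add: a a' vec_eq_iff ultra_class_eq_iff)
  qed
qed


section \<open>Ideals inside the approximation group\<close>

text \<open>A nonzero infinitesimal \<open>e\<close> has the multiple \<open>\<lfloor>1 / (2 e)\<rfloor> e\<close> infinitely close to \<open>1 / 2\<close>,
  with rounding error at most \<open>\<bar>e\<bar>\<close>.\<close>

lemma infinitesimal_multiple_tendsto_half:
  fixes e :: "'a \<Rightarrow> real"
  assumes e0: "(e \<longlongrightarrow> 0) F" and ne: "eventually (\<lambda>k. e k \<noteq> 0) F"
  shows "((\<lambda>k. of_int \<lfloor>1 / (2 * e k)\<rfloor> * e k) \<longlongrightarrow> 1 / 2) F"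
proof -
  have "eventually (\<lambda>k. norm (of_int \<lfloor>1 / (2 * e k)\<rfloor> * e k - 1 / 2) \<le> \<bar>e k\<bar>) F"
    using ne
  proof eventually_elim
    case (elim k)
    let ?x = "1 / (2 * e k)"
    have "\<bar>of_int \<lfloor>?x\<rfloor> - ?x\<bar> \<le> 1" by linarith
    then have "\<bar>of_int \<lfloor>?x\<rfloor> - ?x\<bar> * \<bar>e k\<bar> \<le> 1 * \<bar>e k\<bar>" by (rule mult_right_mono) simp
    moreover have "of_int \<lfloor>?x\<rfloor> * e k - 1 / 2 = (of_int \<lfloor>?x\<rfloor> - ?x) * e k"
      using elim by (simp add: left_diff_distrib)
    ultimately show ?case by (simp only: real_norm_def abs_mult)
  qed
  moreover have "((\<lambda>k. \<bar>e k\<bar>) \<longlongrightarrow> 0) F" using tendsto_rabs[OF e0] by simp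
  ultimately have "((\<lambda>k. of_int \<lfloor>1 / (2 * e k)\<rfloor> * e k - 1 / 2) \<longlongrightarrow> 0) F"
    by (rule Lim_null_comparison)
  then show ?thesis by (simp add: LIM_zero_iff)
qed

lemma of_int_not_tendsto_half:
  assumes "F \<noteq> bot"
  shows "\<not> ((\<lambda>k. real_of_int (z k)) \<longlongrightarrow> 1 / 2) F"
proof
  assume "((\<lambda>k. real_of_int (z k)) \<longlongrightarrow> 1 / 2) F"
  then have "eventually (\<lambda>k. dist (real_of_int (z k)) (1 / 2) < 1 / 2) F" by (rule tendstoD) simp
  then obtain k where "dist (real_of_int (z k)) (1 / 2) < 1 / 2"
    using eventually_happens' assms by blast
  then have "0 < real_of_int (z k)" "real_of_int (z k) < 1" by (auto simp: dist_real_def abs_if split: if_splits)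
  then show False by simp
qed

text \<open>Multiplying \<open>\<Theta> n - m = e\<close> by \<open>l = \<lfloor>1 / (2 e\<^sub>i)\<rfloor>\<close> puts coordinate \<open>i\<close> of \<open>\<Theta> (l n)\<close>
  infinitely close to a hyperinteger plus \<open>1 / 2\<close>, whereas \<open>l n\<close> being in the approximation group puts
  it infinitely close to a hyperinteger.  Only \<open>e\<^sub>i = 0\<close> avoids this conflict.\<close>

lemma error_map_eq_zero_if_multiples_in_dioph_set:
  fixes \<Theta> :: "real ^ 's ^ 'r" and a :: "'s \<Rightarrow> nat \<Rightarrow> int"
  assumes U: "nonprincipal_ultrafilter U"
    and mult: "\<And>l. (\<chi> j. ultra_class U (\<lambda>k. l k * a j k)) \<in> dioph_set U \<Theta>"
  shows "error_map U \<Theta> (\<chi> j. ultra_class U (a j)) = (\<chi> i. ultra_class U (\<lambda>k. 0))"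
proof -
  let ?n = "\<chi> j. ultra_class U (a j)"
  have "?n \<in> dioph_set U \<Theta>" using mult[of "\<lambda>_. 1"] by simp
  then have c: "?n \<in> carrier (vec_power (hyperint U))" by (simp add: dioph_set_def)
  obtain m where m: "is_dual U \<Theta> ?n m" using \<open>?n \<in> dioph_set U \<Theta>\<close> by (auto simp: dioph_set_def)
  obtain b where b: "m = (\<chi> i. ultra_class U (b i))"
    using m unfolding is_dual_def by (blast elim: vec_classE)
  note d = m[unfolded b]
  define e where "e i k = (\<Sum>j\<in>UNIV. \<Theta> $ i $ j * real_of_int (a j k)) - real_of_int (b i k)" for i k
  have e0: "(e i \<longlongrightarrow> 0) U" for i
    using d unfolding is_dual_class e_def by blast
  have "eventually (\<lambda>k. e i k = 0) U" for i
  proof (rule ccontr)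
    assume "\<not> eventually (\<lambda>k. e i k = 0) U"
    then have ne: "eventually (\<lambda>k. e i k \<noteq> 0) U"
      by (rule nonprincipal_ultrafilter_not_eventually[OF U])
    define l where "l k = \<lfloor>1 / (2 * e i k)\<rfloor>" for k
    have half: "((\<lambda>k. of_int (l k) * e i k) \<longlongrightarrow> 1 / 2) U"
      unfolding l_def by (rule infinitesimal_multiple_tendsto_half[OF e0 ne])
    obtain m' where m': "is_dual U \<Theta> (\<chi> j. ultra_class U (\<lambda>k. l k * a j k)) m'"
      using mult[of l] by (auto simp: dioph_set_def)
    obtain b' where b': "m' = (\<chi> i. ultra_class U (b' i))"
      using m' unfolding is_dual_def by (blast elim: vec_classE)
    have "((\<lambda>k. (\<Sum>j\<in>UNIV. \<Theta> $ i $ j * real_of_int (l k * a j k)) - real_of_int (b' i k)) \<longlongrightarrow> 0) U"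
      using m' unfolding b' is_dual_class by blast
    from tendsto_diff[OF half this]
    have "((\<lambda>k. real_of_int (b' i k - l k * b i k)) \<longlongrightarrow> 1 / 2) U"
      by (simp add: e_def right_diff_distrib sum_distrib_left mult_ac)
    moreover have "U \<noteq> bot" using U by (simp add: nonprincipal_ultrafilter_def)
    ultimately show False
      using of_int_not_tendsto_half[of U "\<lambda>k. b' i k - l k * b i k"] by blast
  qed
  then show ?thesis
    unfolding error_map_eq[OF c d] vec_eq_iff approx_diff_class
    by (simp add: ultra_class_eq_iff e_def)
qed

lemma vec_power_hyperint_smult:
  "ultra_class U l \<odot>\<^bsub>vec_power (ultrapower U)\<^esub> (\<chi> j. ultra_class U (a j)) =
     (\<chi> j. ultra_class U (\<lambda>k. l k * a j k))"
  by (simp add: vec_power_def ultrapower_def ultra_lift2_class)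

lemma vec_power_ultrapower_zero:
  "\<zero>\<^bsub>vec_power (ultrapower U)\<^esub> = (\<chi> j. ultra_class U (\<lambda>k. 0))"
  by (simp add: vec_power_def ultrapower_def)

lemma ideal_in_dioph_set_iff:
  fixes \<Theta> :: "real ^ 's ^ 'r"
  assumes U: "nonprincipal_ultrafilter U"
  shows "(\<exists>N. submodule N (hyperint U) (vec_power (hyperint U)) \<and>
              N \<subseteq> dioph_set U \<Theta> \<and> N \<noteq> {\<zero>\<^bsub>vec_power (hyperint U)\<^esub>}) \<longleftrightarrow>
         \<not> inj_on (error_map U \<Theta>) (dioph_set U \<Theta>)" (is "?ideal \<longleftrightarrow> _")
proof
  assume ?ideal
  then obtain N where N: "submodule N (hyperint U) (vec_power (hyperint U))"
    and sub: "N \<subseteq> dioph_set U \<Theta>" and nz: "N \<noteq> {\<zero>\<^bsub>vec_power (hyperint U)\<^esub>}" by blast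
  interpret N: submodule N "hyperint U" "vec_power (hyperint U)" by (rule N)
  have zero: "\<zero>\<^bsub>vec_power (hyperint U)\<^esub> \<in> N" using N.one_closed by simp
  then obtain n where n: "n \<in> N" "n \<noteq> \<zero>\<^bsub>vec_power (hyperint U)\<^esub>" using nz by blast
  have err: "error_map U \<Theta> x = (\<chi> i. ultra_class U (\<lambda>k. 0))" if x: "x \<in> N" for x
  proof -
    obtain a where a: "x = (\<chi> j. ultra_class U (a j))"
      using x sub by (blast elim: dioph_setE)
    have "(\<chi> j. ultra_class U (\<lambda>k. l k * a j k)) \<in> dioph_set U \<Theta>" for l
      using N.smult_closed[of "ultra_class U l" x] x sub
      unfolding a vec_power_hyperint_smult by (auto simp: carrier_ultrapower)
    then show ?thesis unfolding a by (rule error_map_eq_zero_if_multiples_in_dioph_set[OF U])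
  qed
  show "\<not> inj_on (error_map U \<Theta>) (dioph_set U \<Theta>)"
  proof
    assume "inj_on (error_map U \<Theta>) (dioph_set U \<Theta>)"
    then have "n = \<zero>\<^bsub>vec_power (hyperint U)\<^esub>"
      using n(1) zero sub err by (metis inj_onD subsetD)
    then show False using n(2) by simp
  qed
next
  interpret M: module "hyperint U" "vec_power (hyperint U) :: (_, _ ^ 's) module"
    by (rule module_vec_power[OF cring_ultrapower])
  assume "\<not> inj_on (error_map U \<Theta>) (dioph_set U \<Theta>)"
  then obtain a :: "'s \<Rightarrow> int" and j0 where j0: "a j0 \<noteq> 0"
    and a: "\<And>i. (\<Sum>j\<in>UNIV. \<Theta> $ i $ j * real_of_int (a j)) \<in> \<int>"
    unfolding inj_error_map_iff[OF U] has_integer_relation_def by blast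
  define n :: "(nat \<Rightarrow> int) set ^ 's" where "n = (\<chi> j. ultra_class U (\<lambda>_. a j))"
  define N where "N = (\<lambda>x. x \<odot>\<^bsub>vec_power (hyperint U)\<^esub> n) ` carrier (hyperint U)"
  have n: "n \<in> carrier (vec_power (hyperint U))"
    by (simp add: n_def vec_power_def carrier_ultrapower)
  have "submodule N (hyperint U) (vec_power (hyperint U))"
  proof (rule M.submoduleI)
    show "N \<subseteq> carrier (vec_power (hyperint U))" using n by (auto simp: N_def)
    show "\<zero>\<^bsub>vec_power (hyperint U)\<^esub> \<in> N"
      unfolding N_def using n by (intro image_eqI[of _ _ "\<zero>\<^bsub>hyperint U\<^esub>"]) auto
    show "\<ominus>\<^bsub>vec_power (hyperint U)\<^esub> x \<in> N" if x: "x \<in> N" for x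
    proof -
      obtain l where "l \<in> carrier (hyperint U)" "x = l \<odot>\<^bsub>vec_power (hyperint U)\<^esub> n"
        using x by (auto simp: N_def)
      then show ?thesis
        unfolding N_def using n by (intro image_eqI[of _ _ "\<ominus>\<^bsub>hyperint U\<^esub> l"]) (simp_all add: M.smult_l_minus)
    qed
    show "x \<oplus>\<^bsub>vec_power (hyperint U)\<^esub> y \<in> N" if xy: "x \<in> N" "y \<in> N" for x y
    proof -
      obtain l l' where "l \<in> carrier (hyperint U)" "x = l \<odot>\<^bsub>vec_power (hyperint U)\<^esub> n"
        and "l' \<in> carrier (hyperint U)" "y = l' \<odot>\<^bsub>vec_power (hyperint U)\<^esub> n"
        using xy by (auto simp: N_def)
      then show ?thesis
        unfolding N_def using n by (intro image_eqI[of _ _ "l \<oplus>\<^bsub>hyperint U\<^esub> l'"]) (simp_all add: M.smult_l_distr)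
    qed
    show "x \<odot>\<^bsub>vec_power (hyperint U)\<^esub> y \<in> N" if x: "x \<in> carrier (hyperint U)" and y: "y \<in> N" for x y
    proof -
      obtain l where "l \<in> carrier (hyperint U)" "y = l \<odot>\<^bsub>vec_power (hyperint U)\<^esub> n"
        using y by (auto simp: N_def)
      then show ?thesis
        unfolding N_def using x n by (intro image_eqI[of _ _ "x \<otimes>\<^bsub>hyperint U\<^esub> l"]) (simp_all add: M.smult_assoc1)
    qed
  qed
  moreover have "N \<subseteq> dioph_set U \<Theta>"
    using integer_relation_multiple(1)[OF a]
    by (auto simp: N_def n_def carrier_ultrapower vec_power_hyperint_smult)
  moreover have "N \<noteq> {\<zero>\<^bsub>vec_power (hyperint U)\<^esub>}"
  proof -
    have "n \<in> N"
      unfolding N_def using n by (intro image_eqI[of _ _ "\<one>\<^bsub>hyperint U\<^esub>"]) auto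
    moreover have "n \<noteq> \<zero>\<^bsub>vec_power (hyperint U)\<^esub>"
      using j0 U by (auto simp: n_def vec_power_ultrapower_zero vec_eq_iff ultra_class_eq_iff
          nonprincipal_ultrafilter_def)
    ultimately show ?thesis by blast
  qed
  ultimately show ?ideal by blast
qed

theorem theorem8:
  fixes U :: "nat filter" and \<Theta> :: "real ^ 's ^ 'r"
  assumes "nonprincipal_ultrafilter U"
  shows "(inhom_independent \<Theta> \<longleftrightarrow> error_map U \<Theta> \<in> iso (dioph_group U \<Theta>) (error_group U \<Theta>)) \<and>
         (error_map U \<Theta> \<in> iso (dioph_group U \<Theta>) (error_group U \<Theta>) \<longleftrightarrow>
            \<not> (\<exists>N. submodule N (hyperint U) (vec_power (hyperint U)) \<and>
                   N \<subseteq> dioph_set U \<Theta> \<and> N \<noteq> {\<zero>\<^bsub>vec_power (hyperint U)\<^esub>}))"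
  unfolding error_map_iso_iff_inj inhom_independent_iff ideal_in_dioph_set_iff[OF assms]
    inj_error_map_iff[OF assms] by blast

end
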